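(* Let $\Bbbk$ be a field, $R=\Bbbk[[t]]$, and let $X=(X,c)$ be a cyclic poset with covering poset $\pi:\tilde X\to X$. Then there is a natural isomorphism of categories $RX\cong\widehat{\Bbbk X}$.
   Context: $\mathbb N=\{0,1,2,\dots\}$. A poset is a set with a reflexive transitive relation $\le$ (not necessarily antisymmetric); $x\approx y$ means $x\le y$ and $y\le x$; $x<y$ means $x\le y$ and $x\not\approx y$. A covering poset of a set $X$ is a poset $\tilde X$ with a surjection $\pi:\tilde X\to X$ such that (1) each $\pi^{-1}(x)$ is isomorphic as a poset to $\mathbb Z$; (2) there is a poset automorphism $\sigma$ of $\tilde X$ such that $\sigma\tilde x$ is the smallest element of $\pi^{-1}(\pi(\tilde x))$ greater than $\tilde x$; (3) for all $\tilde x,\tilde y$ there is an integer $m\ge0$ with $\tilde x\le\sigma^m\tilde y\le\sigma^{2m}\tilde x$. For a section $\lambda$ of $\pi$, let $b_\lambda(xy)$ be the smallest integer $m$ with $\lambda(x)\le\sigma^m\lambda(y)$; the structure cocycle of $\tilde X$ is $c(xyz)=b_\lambda(yz)-b_\lambda(xz)+b_\lambda(xy)$ (independent of $\lambda$). A cyclic poset is a pair $(X,c)$ with $c:X^3\to\mathbb N$ a reduced cocycle: $c(xyz)-c(wyz)+c(wxz)-c(wxy)=0$ and $c(xxy)=c(xyy)=0$. Every such $c$ is the structure cocycle of a covering poset, unique up to $\sigma$-equivariant poset isomorphism over $X$. $RX$ is the $R$-category with object set $X$ (the object corresponding to $x$ also being written $P_x$), with $RX(x,y)$ the free $R$-module on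 one generator $f_{xy}$ and composition $(rf_{yz})\circ(sf_{xy})=rst^{c(xyz)}f_{xz}$. The completed linearization $\widehat{\Bbbk X}$ is the category with objects the elements of $X$, in which a morphism $f:x\to y$ is an infinite matrix $f=(f_{ba})$ with entries in $\Bbbk$, indexed by $a\in\pi^{-1}(x)$, $b\in\pi^{-1}(y)$, such that $f_{ba}=0$ if $b\not\ge a$ and $f_{ba}=f_{\sigma(b)\sigma(a)}$ for all $a,b$. The composition $h=f\circ g$ of $g:x\to y$ and $f:y\to z$ is $h_{ca}=\sum_{b\in\pi^{-1}(y)}f_{cb}g_{ba}$. *)

theory Defs
  imports "HOL-Computational_Algebra.Formal_Power_Series"
begin

section \<open>Categories with explicit hom-sets\<close>

text \<open>Hom-sets of different pairs of objects need not be disjoint, so composition and the action of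
  a functor on morphisms carry their objects as arguments: \<open>comp C x y z g f\<close> is
  \<open>g \<circ> f\<close> for \<open>f : x \<rightarrow> y\<close> and \<open>g : y \<rightarrow> z\<close>.\<close>

record ('o, 'm) cat =
  obj :: "'o set"
  hom :: "'o \<Rightarrow> 'o \<Rightarrow> 'm set"
  ident :: "'o \<Rightarrow> 'm"
  comp :: "'o \<Rightarrow> 'o \<Rightarrow> 'o \<Rightarrow> 'm \<Rightarrow> 'm \<Rightarrow> 'm"

definition category :: "('o, 'm) cat \<Rightarrow> bool" where
  "category C \<longleftrightarrow>
     (\<forall>x\<in>obj C. ident C x \<in> hom C x x) \<and>
     (\<forall>x\<in>obj C. \<forall>y\<in>obj C. \<forall>z\<in>obj C. \<forall>f\<in>hom C x y. \<forall>g\<in>hom C y z.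
        comp C x y z g f \<in> hom C x z) \<and>
     (\<forall>x\<in>obj C. \<forall>y\<in>obj C. \<forall>f\<in>hom C x y.
        comp C x x y f (ident C x) = f \<and> comp C x y y (ident C y) f = f) \<and>
     (\<forall>w\<in>obj C. \<forall>x\<in>obj C. \<forall>y\<in>obj C. \<forall>z\<in>obj C.
        \<forall>f\<in>hom C w x. \<forall>g\<in>hom C x y. \<forall>h\<in>hom C y z.
        comp C w y z h (comp C w x y g f) = comp C w x z (comp C x y z h g) f)"

record ('o, 'm, 'p, 'n) functr =
  on_obj :: "'o \<Rightarrow> 'p"
  on_mor :: "'o \<Rightarrow> 'o \<Rightarrow> 'm \<Rightarrow> 'n"

definition is_functor ::
  "('o, 'm) cat \<Rightarrow> ('p, 'n) cat \<Rightarrow> ('o, 'm, 'p, 'n) functr \<Rightarrow> bool" where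
  "is_functor C D F \<longleftrightarrow>
     category C \<and> category D \<and>
     (\<forall>x\<in>obj C. on_obj F x \<in> obj D) \<and>
     (\<forall>x\<in>obj C. \<forall>y\<in>obj C. \<forall>f\<in>hom C x y.
        on_mor F x y f \<in> hom D (on_obj F x) (on_obj F y)) \<and>
     (\<forall>x\<in>obj C. on_mor F x x (ident C x) = ident D (on_obj F x)) \<and>
     (\<forall>x\<in>obj C. \<forall>y\<in>obj C. \<forall>z\<in>obj C. \<forall>f\<in>hom C x y. \<forall>g\<in>hom C y z.
        on_mor F x z (comp C x y z g f) =
        comp D (on_obj F x) (on_obj F y) (on_obj F z) (on_mor F y z g) (on_mor F x y f))"

definition id_functor :: "('o, 'm, 'o, 'm) functr" where
  "id_functor = \<lparr>on_obj = (\<lambda>x. x), on_mor = (\<lambda>x y f. f)\<rparr>"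

definition functor_comp ::
  "('p, 'n, 'q, 'l) functr \<Rightarrow> ('o, 'm, 'p, 'n) functr \<Rightarrow> ('o, 'm, 'q, 'l) functr" where
  "functor_comp G F =
     \<lparr>on_obj = (\<lambda>x. on_obj G (on_obj F x)),
      on_mor = (\<lambda>x y f. on_mor G (on_obj F x) (on_obj F y) (on_mor F x y f))\<rparr>"

text \<open>Equality of functors out of \<open>C\<close>, ignoring values outside the objects and hom-sets of
  \<open>C\<close>.\<close>

definition functor_eq ::
  "('o, 'm) cat \<Rightarrow> ('o, 'm, 'p, 'n) functr \<Rightarrow> ('o, 'm, 'p, 'n) functr \<Rightarrow> bool" where
  "functor_eq C F G \<longleftrightarrow>
     (\<forall>x\<in>obj C. on_obj F x = on_obj G x) \<and>
     (\<forall>x\<in>obj C. \<forall>y\<in>obj C. \<forall>f\<in>hom C x y. on_mor F x y f = on_mor G x y f)"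

definition category_isomorphism ::
  "('o, 'm) cat \<Rightarrow> ('p, 'n) cat \<Rightarrow> ('o, 'm, 'p, 'n) functr \<Rightarrow> bool" where
  "category_isomorphism C D F \<longleftrightarrow>
     is_functor C D F \<and>
     (\<exists>G. is_functor D C G \<and>
        functor_eq C (functor_comp G F) id_functor \<and>
        functor_eq D (functor_comp F G) id_functor)"


section \<open>Cyclic posets and covering posets\<close>

definition cyclic_poset :: "'x set \<Rightarrow> ('x \<Rightarrow> 'x \<Rightarrow> 'x \<Rightarrow> nat) \<Rightarrow> bool" where
  "cyclic_poset X c \<longleftrightarrow>
     (\<forall>w\<in>X. \<forall>x\<in>X. \<forall>y\<in>X. \<forall>z\<in>X.
        int (c x y z) - int (c w y z) + int (c w x z) - int (c w x y) = 0) \<and>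
     (\<forall>x\<in>X. \<forall>y\<in>X. c x x y = 0 \<and> c x y y = 0)"

text \<open>A cyclic poset \<open>(base, cocycle)\<close> together with a covering
  \<open>proj : total \<rightarrow> base\<close>; \<open>leq\<close> is the order of the covering poset and
  \<open>shift\<close> is the automorphism \<open>\<sigma>\<close>.\<close>

record ('x, 'a) cyclic_cover =
  base :: "'x set"
  cocycle :: "'x \<Rightarrow> 'x \<Rightarrow> 'x \<Rightarrow> nat"
  total :: "'a set"
  leq :: "'a \<Rightarrow> 'a \<Rightarrow> bool"
  proj :: "'a \<Rightarrow> 'x"
  shift :: "'a \<Rightarrow> 'a"

definition fibre :: "('x, 'a) cyclic_cover \<Rightarrow> 'x \<Rightarrow> 'a set" where
  "fibre D x = {a \<in> total D. proj D a = x}"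

text \<open>Posets are not assumed antisymmetric, so \<open>a < b\<close> means that \<open>a \<le> b\<close>
  and not \<open>a \<approx> b\<close>.\<close>

definition lt :: "('x, 'a) cyclic_cover \<Rightarrow> 'a \<Rightarrow> 'a \<Rightarrow> bool" where
  "lt D a b \<longleftrightarrow> leq D a b \<and> \<not> (leq D a b \<and> leq D b a)"

definition covering_poset :: "('x, 'a) cyclic_cover \<Rightarrow> bool" where
  "covering_poset D \<longleftrightarrow>
     (\<forall>a\<in>total D. leq D a a) \<and>
     (\<forall>a\<in>total D. \<forall>b\<in>total D. \<forall>d\<in>total D. leq D a b \<longrightarrow> leq D b d \<longrightarrow> leq D a d) \<and>
     proj D ` total D = base D \<and>
     (\<forall>x\<in>base D. \<exists>h. bij_betw h (fibre D x) (UNIV :: int set) \<and>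
        (\<forall>a\<in>fibre D x. \<forall>b\<in>fibre D x. leq D a b \<longleftrightarrow> h a \<le> h b)) \<and>
     bij_betw (shift D) (total D) (total D) \<and>
     (\<forall>a\<in>total D. \<forall>b\<in>total D. leq D (shift D a) (shift D b) \<longleftrightarrow> leq D a b) \<and>
     (\<forall>a\<in>total D. shift D a \<in> fibre D (proj D a) \<and> lt D a (shift D a) \<and>
        (\<forall>b\<in>fibre D (proj D a). lt D a b \<longrightarrow> leq D (shift D a) b)) \<and>
     (\<forall>a\<in>total D. \<forall>b\<in>total D. \<exists>m::nat.
        leq D a ((shift D ^^ m) b) \<and> leq D ((shift D ^^ m) b) ((shift D ^^ (2 * m)) a))"

definition shift_pow :: "('x, 'a) cyclic_cover \<Rightarrow> int \<Rightarrow> 'a \<Rightarrow> 'a" where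
  "shift_pow D m =
     (if 0 \<le> m then shift D ^^ nat m else inv_into (total D) (shift D) ^^ nat (- m))"

definition is_section :: "('x, 'a) cyclic_cover \<Rightarrow> ('x \<Rightarrow> 'a) \<Rightarrow> bool" where
  "is_section D s \<longleftrightarrow> (\<forall>x\<in>base D. s x \<in> fibre D x)"

definition b_sec :: "('x, 'a) cyclic_cover \<Rightarrow> ('x \<Rightarrow> 'a) \<Rightarrow> 'x \<Rightarrow> 'x \<Rightarrow> int" where
  "b_sec D s x y = (LEAST m. leq D (s x) (shift_pow D m (s y)))"

text \<open>The right-hand side does not depend on the section \<open>s\<close>, so it is immaterial whether
  the section is quantified existentially or universally.\<close>

definition structure_cocycle :: "('x, 'a) cyclic_cover \<Rightarrow> ('x \<Rightarrow> 'x \<Rightarrow> 'x \<Rightarrow> nat) \<Rightarrow> bool" where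
  "structure_cocycle D c \<longleftrightarrow>
     (\<exists>s. is_section D s \<and>
        (\<forall>x\<in>base D. \<forall>y\<in>base D. \<forall>z\<in>base D.
           int (c x y z) = b_sec D s y z - b_sec D s x z + b_sec D s x y))"

definition covered_cyclic_poset :: "('x, 'a) cyclic_cover \<Rightarrow> bool" where
  "covered_cyclic_poset D \<longleftrightarrow>
     cyclic_poset (base D) (cocycle D) \<and> covering_poset D \<and> structure_cocycle D (cocycle D)"

text \<open>Isomorphisms of covering posets: \<open>q\<close> is a \<open>\<sigma>\<close>-equivariant poset
  isomorphism lying over the bijection \<open>p\<close> of the base sets.\<close>

definition cover_iso ::
  "('x, 'a) cyclic_cover \<Rightarrow> ('y, 'b) cyclic_cover \<Rightarrow> ('x \<Rightarrow> 'y) \<Rightarrow> ('a \<Rightarrow> 'b) \<Rightarrow> bool" where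
  "cover_iso D E p q \<longleftrightarrow>
     bij_betw p (base D) (base E) \<and>
     bij_betw q (total D) (total E) \<and>
     (\<forall>a\<in>total D. \<forall>b\<in>total D. leq E (q a) (q b) \<longleftrightarrow> leq D a b) \<and>
     (\<forall>a\<in>total D. proj E (q a) = p (proj D a)) \<and>
     (\<forall>a\<in>total D. q (shift D a) = shift E (q a))"


section \<open>The two linearizations\<close>

text \<open>The category \<open>RX\<close> for a commutative ring \<open>R\<close> with an element \<open>t\<close>.
  The free module on the generator \<open>f\<^sub>x\<^sub>y\<close> is encoded by coordinates: the ring element
  \<open>r\<close>, as a morphism from \<open>x\<close> to \<open>y\<close>, stands for \<open>r f\<^sub>x\<^sub>y\<close>.
  The identity of \<open>x\<close> is \<open>f\<^sub>x\<^sub>x\<close> because the cocycle is reduced.\<close>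

definition linearization ::
  "'r::comm_ring_1 \<Rightarrow> 'x set \<Rightarrow> ('x \<Rightarrow> 'x \<Rightarrow> 'x \<Rightarrow> nat) \<Rightarrow> ('x, 'r) cat" where
  "linearization t X c =
     \<lparr>obj = X,
      hom = (\<lambda>x y. UNIV),
      ident = (\<lambda>x. 1),
      comp = (\<lambda>x y z r s. r * s * t ^ c x y z)\<rparr>"

text \<open>The matrix entry written \<open>f\<^sub>b\<^sub>a\<close> is \<open>f b a\<close>. Matrices are extended by
  zero outside \<open>fibre D y \<times> fibre D x\<close>, so that equal matrices are equal functions. In the
  composition only finitely many terms of the sum over the fibre are nonzero, and the sum is taken
  over these.\<close>

definition completed_linearization ::
  "('x, 'a) cyclic_cover \<Rightarrow> ('x, 'a \<Rightarrow> 'a \<Rightarrow> 'k::field) cat" where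
  "completed_linearization D =
     \<lparr>obj = base D,
      hom = (\<lambda>x y. {f.
        (\<forall>b a. \<not> (b \<in> fibre D y \<and> a \<in> fibre D x) \<longrightarrow> f b a = 0) \<and>
        (\<forall>a\<in>fibre D x. \<forall>b\<in>fibre D y. \<not> leq D a b \<longrightarrow> f b a = 0) \<and>
        (\<forall>a\<in>fibre D x. \<forall>b\<in>fibre D y. f b a = f (shift D b) (shift D a))}),
      ident = (\<lambda>x b a. if a \<in> fibre D x \<and> b = a then 1 else 0),
      comp = (\<lambda>x y z f g d a. \<Sum>b | b \<in> fibre D y \<and> f d b * g b a \<noteq> 0. f d b * g b a)\<rparr>"

text \<open>The functors induced by an isomorphism \<open>(p, q)\<close> of covering posets: the first sends
  \<open>r f\<^sub>x\<^sub>y\<close> to \<open>r f\<^sub>p\<^sub>x\<^sub>,\<^sub>p\<^sub>y\<close>, and the second relabels matrix indices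
  along \<open>q\<close>.\<close>

definition linearization_map :: "('x \<Rightarrow> 'y) \<Rightarrow> ('x, 'r, 'y, 'r) functr" where
  "linearization_map p = \<lparr>on_obj = p, on_mor = (\<lambda>x y r. r)\<rparr>"

definition completed_linearization_map ::
  "('x, 'a) cyclic_cover \<Rightarrow> ('y, 'b) cyclic_cover \<Rightarrow> ('x \<Rightarrow> 'y) \<Rightarrow> ('a \<Rightarrow> 'b) \<Rightarrow>
     ('x, 'a \<Rightarrow> 'a \<Rightarrow> 'k::field, 'y, 'b \<Rightarrow> 'b \<Rightarrow> 'k) functr" where
  "completed_linearization_map D E p q =
     \<lparr>on_obj = p,
      on_mor = (\<lambda>x y f b a.
        if b \<in> total E \<and> a \<in> total E
        then f (inv_into (total D) q b) (inv_into (total D) q a) else 0)\<rparr>"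

definition linear_on_homs ::
  "'x set \<Rightarrow> ('x, 'k::field fps, 'x, 'a \<Rightarrow> 'a \<Rightarrow> 'k) functr \<Rightarrow> bool" where
  "linear_on_homs X F \<longleftrightarrow>
     (\<forall>x\<in>X. \<forall>y\<in>X. \<forall>r s u b a.
        on_mor F x y (r + s) b a = on_mor F x y r b a + on_mor F x y s b a \<and>
        on_mor F x y (fps_const u * r) b a = u * on_mor F x y r b a)"

end

theory Submission
  imports Defs
begin

text \<open>A section of the covering puts the fibres in bijection with the integers by a height
  \<open>\<kappa>\<close> that increases by one under \<open>\<sigma>\<close>. In these coordinates
  \<open>a \<le> b\<close>, for \<open>a\<close> over \<open>x\<close> and \<open>b\<close> over \<open>y\<close>, means that
  \<open>\<kappa> b - \<kappa> a - \<beta> x y\<close> is nonnegative, where \<open>\<beta>\<close> is \<open>b\<^sub>\<lambda>\<close>.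
  An equivariant matrix depends only on this difference, hence is a power series, and
  \<open>c = \<delta>\<beta>\<close> turns matrix multiplication into multiplication of series up to the factor
  \<open>t\<^sup>c\<close>. The same difference is the largest \<open>n\<close> with
  \<open>\<sigma>\<^sup>n a \<le> b\<close>; this description does not mention the section, which gives naturality.\<close>

section \<open>Isomorphisms of categories from bijections of hom-sets\<close>

text \<open>Every composite in \<open>D\<close> is the image of a composite in \<open>C\<close>, so
  the category laws pass from \<open>C\<close> to \<open>D\<close>. Associativity of matrix
  composition is obtained in this way, without rearranging sums over fibres.\<close>

lemma category_isomorphism_if_bij_betw_hom:
  assumes C: "category C" and obj: "obj D = obj C"
    and bij: "\<And>x y. x \<in> obj C \<Longrightarrow> y \<in> obj C \<Longrightarrow> bij_betw (\<Phi> x y) (hom C x y) (hom D x y)"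
    and ident: "\<And>x. x \<in> obj C \<Longrightarrow> \<Phi> x x (ident C x) = ident D x"
    and comp: "\<And>x y z f g. x \<in> obj C \<Longrightarrow> y \<in> obj C \<Longrightarrow> z \<in> obj C \<Longrightarrow>
      f \<in> hom C x y \<Longrightarrow> g \<in> hom C y z \<Longrightarrow>
      \<Phi> x z (comp C x y z g f) = comp D x y z (\<Phi> y z g) (\<Phi> x y f)"
  shows "category_isomorphism C D \<lparr>on_obj = (\<lambda>x. x), on_mor = \<Phi>\<rparr>"
proof -
  define \<Psi> where "\<Psi> x y = inv_into (hom C x y) (\<Phi> x y)" for x y
  note ident_mem = C[unfolded category_def, THEN conjunct1, rule_format]
    and comp_mem = C[unfolded category_def, THEN conjunct2, THEN conjunct1, rule_format]
    and unit = C[unfolded category_def, THEN conjunct2, THEN conjunct2, THEN conjunct1, rule_format]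
    and assoc = C[unfolded category_def, THEN conjunct2, THEN conjunct2, THEN conjunct2, rule_format]
  have \<Phi>_mem: "\<Phi> x y f \<in> hom D x y" if "x \<in> obj C" "y \<in> obj C" "f \<in> hom C x y" for x y f
    using bij_betwE[OF bij] that by blast
  have \<Psi>_mem: "\<Psi> x y f \<in> hom C x y" and \<Phi>\<Psi>: "\<Phi> x y (\<Psi> x y f) = f"
    if "x \<in> obj C" "y \<in> obj C" "f \<in> hom D x y" for x y f
    using bij[OF that(1,2)] that(3) unfolding \<Psi>_def bij_betw_def
    by (auto intro: inv_into_into f_inv_into_f)
  have \<Psi>\<Phi>: "\<Psi> x y (\<Phi> x y f) = f" if "x \<in> obj C" "y \<in> obj C" "f \<in> hom C x y" for x y f
    using bij_betw_inv_into_left[OF bij] that unfolding \<Psi>_def by blast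
  have comp_D: "comp D x y z g f = \<Phi> x z (comp C x y z (\<Psi> y z g) (\<Psi> x y f))"
    if "x \<in> obj C" "y \<in> obj C" "z \<in> obj C" "f \<in> hom D x y" "g \<in> hom D y z" for x y z f g
    using that by (simp add: comp \<Psi>_mem \<Phi>\<Psi>)
  have D: "category D"
    unfolding category_def obj
    by (simp add: comp_D \<Phi>_mem \<Psi>_mem \<Psi>\<Phi> \<Phi>\<Psi> comp_mem ident_mem unit assoc flip: ident)
  have "is_functor C D \<lparr>on_obj = (\<lambda>x. x), on_mor = \<Phi>\<rparr>"
    unfolding is_functor_def using C D by (simp add: obj \<Phi>_mem ident comp)
  moreover have "is_functor D C \<lparr>on_obj = (\<lambda>x. x), on_mor = \<Psi>\<rparr>"
    unfolding is_functor_def using C D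
    by (simp add: obj \<Psi>_mem comp_D \<Psi>\<Phi> comp_mem ident_mem flip: ident)
  ultimately show ?thesis
    unfolding category_isomorphism_def functor_eq_def functor_comp_def id_functor_def
    by (intro conjI exI[of _ "\<lparr>on_obj = (\<lambda>x. x), on_mor = \<Psi>\<rparr>"])
      (simp_all add: obj \<Psi>\<Phi> \<Phi>\<Psi>)
qed

section \<open>The category \<open>RX\<close>\<close>

text \<open>In the exponents of \<open>t\<close>, associativity is the cocycle identity and the unit
  laws are reducedness.\<close>

lemma category_linearization:
  assumes "cyclic_poset X c"
  shows "category (linearization t X c)"
proof -
  have "c w y z + c w x y = c w x z + c x y z" if "w \<in> X" "x \<in> X" "y \<in> X" "z \<in> X" for w x y z
  proof -
    have "int (c x y z) - int (c w y z) + int (c w x z) - int (c w x y) = 0"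
      using assms that unfolding cyclic_poset_def by blast
    then show ?thesis by linarith
  qed
  then have pow: "t ^ c w y z * t ^ c w x y = t ^ c w x z * t ^ c x y z"
    if "w \<in> X" "x \<in> X" "y \<in> X" "z \<in> X" for w x y z
    using that by (simp flip: power_add)
  have "h * (g * f * t ^ c w x y) * t ^ c w y z = h * g * t ^ c x y z * f * t ^ c w x z"
    if "w \<in> X" "x \<in> X" "y \<in> X" "z \<in> X" for w x y z f g h
  proof -
    have "h * (g * f * t ^ c w x y) * t ^ c w y z = h * g * f * (t ^ c w y z * t ^ c w x y)"
      by (simp add: ac_simps)
    also have "t ^ c w y z * t ^ c w x y = t ^ c w x z * t ^ c x y z"
      using that by (rule pow)
    finally show ?thesis
      by (simp add: ac_simps)
  qed
  then show ?thesis
    using assms unfolding category_def linearization_def cyclic_poset_def by simp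
qed

section \<open>Power series indexed by the integers\<close>

text \<open>With zero coefficients in negative degrees, the order condition on matrix entries
  becomes the vanishing of a coefficient.\<close>

definition int_coeff :: "'k::zero fps \<Rightarrow> int \<Rightarrow> 'k" where
  "int_coeff r i = (if 0 \<le> i then fps_nth r (nat i) else 0)"

lemma int_coeff_mult_fps_X_power:
  "int_coeff (r * fps_X ^ n) i = int_coeff (r :: 'k::comm_ring_1 fps) (i - int n)"
  by (auto simp: int_coeff_def fps_X_power_mult_right_nth nat_diff_distrib')

text \<open>Only indices from 0 to \<open>N\<close> contribute, which leaves the Cauchy product.
  Summing over the nonzero terms matches the composition of matrices.\<close>

lemma sum_int_coeff_mult:
  fixes r s :: "'k::comm_ring_1 fps"
  shows "(\<Sum>i | int_coeff r (N - i) * int_coeff s i \<noteq> 0. int_coeff r (N - i) * int_coeff s i) =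
    int_coeff (r * s) N"
proof -
  have "(\<Sum>i | int_coeff r (N - i) * int_coeff s i \<noteq> 0. int_coeff r (N - i) * int_coeff s i) =
      (\<Sum>i\<in>{0..N}. int_coeff r (N - i) * int_coeff s i)"
    by (rule sum.mono_neutral_left) (auto simp: int_coeff_def split: if_splits)
  also have "\<dots> = int_coeff (r * s) N"
  proof (cases "0 \<le> N")
    case True
    have "(\<Sum>i\<in>{0..N}. int_coeff r (N - i) * int_coeff s i) =
        (\<Sum>i=0..nat N. fps_nth s i * fps_nth r (nat N - i))"
      by (rule sum.reindex_bij_witness[of _ int nat])
        (use True in \<open>auto simp: int_coeff_def nat_diff_distrib'\<close>)
    then show ?thesis
      using True by (simp add: int_coeff_def fps_mult_nth mult.commute[of r])
  qed (simp add: int_coeff_def)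
  finally show ?thesis .
qed

section \<open>Integer heights on the fibres\<close>

text \<open>The order is left out, so that these facts are available before the order between
  different fibres has been put into coordinates.\<close>

locale graded_cover =
  fixes D :: "('x, 'a) cyclic_cover" and \<kappa> :: "'a \<Rightarrow> int"
  assumes bij_\<kappa>: "x \<in> base D \<Longrightarrow> bij_betw \<kappa> (fibre D x) UNIV"
    and shift_fibre: "a \<in> fibre D x \<Longrightarrow> shift D a \<in> fibre D x"
    and \<kappa>_shift: "a \<in> fibre D x \<Longrightarrow> \<kappa> (shift D a) = \<kappa> a + 1"
begin

lemma \<kappa>_inject:
  "x \<in> base D \<Longrightarrow> a \<in> fibre D x \<Longrightarrow> b \<in> fibre D x \<Longrightarrow> \<kappa> a = \<kappa> b \<longleftrightarrow> a = b"
  using bij_\<kappa>[of x] by (auto simp: bij_betw_def inj_on_def)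

definition at_height :: "'x \<Rightarrow> int \<Rightarrow> 'a" where
  "at_height x = inv_into (fibre D x) \<kappa>"

lemma at_height_fibre [simp]: "x \<in> base D \<Longrightarrow> at_height x i \<in> fibre D x"
  and \<kappa>_at_height [simp]: "x \<in> base D \<Longrightarrow> \<kappa> (at_height x i) = i"
  using bij_\<kappa>[of x] unfolding at_height_def bij_betw_def
  by (auto intro: inv_into_into f_inv_into_f)

lemma at_height_\<kappa> [simp]: "x \<in> base D \<Longrightarrow> a \<in> fibre D x \<Longrightarrow> at_height x (\<kappa> a) = a"
  using bij_betw_inv_into_left[OF bij_\<kappa>] unfolding at_height_def by blast

lemma shift_funpow:
  "a \<in> fibre D x \<Longrightarrow> (shift D ^^ n) a \<in> fibre D x \<and> \<kappa> ((shift D ^^ n) a) = \<kappa> a + int n"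
  by (induction n) (auto simp: shift_fibre \<kappa>_shift)

text \<open>The orbits of the diagonal shift on pairs of fibre elements are the level sets of the
  height difference. \<open>P\<close> is arbitrary because it will be a matrix and also the order
  relation.\<close>

lemma shift_invariant_depends_on_difference:
  assumes inv: "\<And>a b. a \<in> fibre D x \<Longrightarrow> b \<in> fibre D y \<Longrightarrow> P (shift D b) (shift D a) = P b a"
    and xy: "x \<in> base D" "y \<in> base D"
    and "a \<in> fibre D x" "b \<in> fibre D y" "a' \<in> fibre D x" "b' \<in> fibre D y"
    and "\<kappa> b - \<kappa> a = \<kappa> b' - \<kappa> a'"
  shows "P b a = P b' a'"
  using assms(4-)
\<comment> \<open>Taking \<open>a\<close> as the lower of the two elements makes the exponent
  \<open>n\<close> below a natural number.\<close>
proof (induction "\<kappa> a" "\<kappa> a'" arbitrary: a b a' b' rule: linorder_wlog)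
  case le
  define n where "n = nat (\<kappa> a' - \<kappa> a)"
  have "a' = (shift D ^^ n) a" "b' = (shift D ^^ n) b"
    using le shift_funpow xy by (auto simp: n_def simp flip: \<kappa>_inject)
  moreover have "P ((shift D ^^ n) b) ((shift D ^^ n) a) = P b a"
    by (induction n) (simp_all add: inv shift_funpow le)
  ultimately show ?case by simp
next
  case sym
  then show ?case by force
qed

end

section \<open>Power series as equivariant matrices\<close>

text \<open>In a covered cyclic poset a greatest \<open>n\<close> exists exactly when
  \<open>a\<close> is below \<open>b\<close>, which is why \<open>matrix_of\<close> tests the order
  first.\<close>

definition excess :: "('x, 'a) cyclic_cover \<Rightarrow> 'a \<Rightarrow> 'a \<Rightarrow> nat" where
  "excess D a b = (GREATEST n. leq D ((shift D ^^ n) a) b)"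

text \<open>The monomial t^n on the generator becomes the 0/1 matrix with a 1 at \<open>b\<close>,
  \<open>a\<close> exactly when \<open>b\<close> is the n-th successor, in its fibre, of the
  smallest element that is at least \<open>a\<close>.\<close>

definition matrix_of ::
  "('x, 'a) cyclic_cover \<Rightarrow> 'x \<Rightarrow> 'x \<Rightarrow> 'k::zero fps \<Rightarrow> 'a \<Rightarrow> 'a \<Rightarrow> 'k" where
  "matrix_of D x y r b a =
     (if a \<in> fibre D x \<and> b \<in> fibre D y \<and> leq D a b then fps_nth r (excess D a b) else 0)"

text \<open>The covering in coordinates: with \<open>leq_iff\<close> and \<open>cocycle\<close>, the
  isomorphism becomes integer arithmetic. \<open>charted_cover_exists\<close> supplies the heights
  and \<open>\<beta>\<close>.\<close>

locale charted_cover = graded_cover D \<kappa> for D :: "('x, 'a) cyclic_cover" and \<kappa> +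
  fixes \<beta> :: "'x \<Rightarrow> 'x \<Rightarrow> int"
  assumes leq_iff: "x \<in> base D \<Longrightarrow> y \<in> base D \<Longrightarrow> a \<in> fibre D x \<Longrightarrow> b \<in> fibre D y \<Longrightarrow>
      leq D a b \<longleftrightarrow> 0 \<le> \<kappa> b - \<kappa> a - \<beta> x y"
    and cyclic_poset: "cyclic_poset (base D) (cocycle D)"
    and cocycle: "x \<in> base D \<Longrightarrow> y \<in> base D \<Longrightarrow> z \<in> base D \<Longrightarrow>
      int (cocycle D x y z) = \<beta> y z - \<beta> x z + \<beta> x y"
begin

lemma \<beta>_refl: "x \<in> base D \<Longrightarrow> \<beta> x x = 0"
  using cyclic_poset cocycle[of x x x] unfolding cyclic_poset_def by simp

text \<open>Applying the shift \<open>n\<close> times raises the height by \<open>n\<close>, so by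
  \<open>leq_iff\<close> the admissible \<open>n\<close> are those up to the right-hand
  side.\<close>

lemma excess_eq:
  assumes "x \<in> base D" "y \<in> base D" "a \<in> fibre D x" "b \<in> fibre D y" "leq D a b"
  shows "int (excess D a b) = \<kappa> b - \<kappa> a - \<beta> x y"
proof -
  have "excess D a b = nat (\<kappa> b - \<kappa> a - \<beta> x y)"
    unfolding excess_def
    by (rule Greatest_equality)
      (use assms shift_funpow[OF assms(3)] leq_iff[OF assms(1,2) _ assms(4)] in auto)
  then show ?thesis
    using assms leq_iff by simp
qed

lemma matrix_of_eq:
  assumes "x \<in> base D" "y \<in> base D"
  shows "matrix_of D x y r b a =
    (if a \<in> fibre D x \<and> b \<in> fibre D y then int_coeff r (\<kappa> b - \<kappa> a - \<beta> x y) else 0)"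
  using assms leq_iff excess_eq by (auto simp: matrix_of_def int_coeff_def simp flip: excess_eq)

text \<open>A middle element \<open>b\<close> contributes degree
  \<open>i = \<kappa> b - \<kappa> a - \<beta> x y\<close> of \<open>s\<close> and degree
  \<open>N - i\<close> of \<open>r\<close>, so the sum is a Cauchy product. Its total degree
  \<open>N\<close> falls short of \<open>\<kappa> d - \<kappa> a - \<beta> x z\<close> by the
  cocycle, whence the power of \<open>fps_X\<close>.\<close>

lemma matrix_of_comp:
  fixes r s :: "'k::field fps"
  assumes "x \<in> base D" "y \<in> base D" "z \<in> base D"
  shows "matrix_of D x z (r * s * fps_X ^ cocycle D x y z) d a =
    (\<Sum>b | b \<in> fibre D y \<and> matrix_of D y z r d b * matrix_of D x y s b a \<noteq> 0.
      matrix_of D y z r d b * matrix_of D x y s b a)" (is "_ = ?sum")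
proof (cases "a \<in> fibre D x \<and> d \<in> fibre D z")
  case True
  define N where "N = \<kappa> d - \<kappa> a - \<beta> y z - \<beta> x y"
  have "?sum = (\<Sum>i | int_coeff r (N - i) * int_coeff s i \<noteq> 0. int_coeff r (N - i) * int_coeff s i)"
    by (rule sum.reindex_bij_witness[of _ "\<lambda>i. at_height y (i + \<kappa> a + \<beta> x y)"
          "\<lambda>b. \<kappa> b - \<kappa> a - \<beta> x y"])
      (use assms True in \<open>auto simp: matrix_of_eq N_def algebra_simps\<close>)
  also have "\<dots> = int_coeff (r * s * fps_X ^ cocycle D x y z) (\<kappa> d - \<kappa> a - \<beta> x z)"
    unfolding sum_int_coeff_mult int_coeff_mult_fps_X_power
    using assms by (simp add: cocycle N_def algebra_simps)
  finally show ?thesis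
    using assms True by (simp add: matrix_of_eq)
next
  case False
  then have "matrix_of D y z r d b * matrix_of D x y s b a = 0" for b
    by (auto simp: matrix_of_def)
  with False show ?thesis
    by (auto simp: matrix_of_def)
qed

lemma bij_betw_matrix_of:
  assumes xy: "x \<in> base D" "y \<in> base D"
  shows "bij_betw (matrix_of D x y) (UNIV :: 'k::field fps set) (hom (completed_linearization D) x y)"
proof (rule bij_betw_byWitness)
  \<comment> \<open>The inverse reads one column, that of the element of height 0 over
    \<open>x\<close>, from height \<open>\<beta> x y\<close> upwards: there lies the smallest
    element above it.\<close>
  let ?series = "\<lambda>f :: 'a \<Rightarrow> 'a \<Rightarrow> 'k. Abs_fps (\<lambda>n. f (at_height y (int n + \<beta> x y)) (at_height x 0))"
  show "\<forall>r\<in>UNIV. ?series (matrix_of D x y r) = r"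
    using xy by (simp add: matrix_of_eq int_coeff_def fps_eq_iff)
  show "\<forall>f\<in>hom (completed_linearization D) x y. matrix_of D x y (?series f) = f"
  proof (intro ballI ext)
    fix f :: "'a \<Rightarrow> 'a \<Rightarrow> 'k" and b a
    assume "f \<in> hom (completed_linearization D) x y"
    then have supp: "\<not> (b \<in> fibre D y \<and> a \<in> fibre D x) \<Longrightarrow> f b a = 0"
      and tri: "a \<in> fibre D x \<Longrightarrow> b \<in> fibre D y \<Longrightarrow> \<not> leq D a b \<Longrightarrow> f b a = 0"
      and inv: "a \<in> fibre D x \<Longrightarrow> b \<in> fibre D y \<Longrightarrow> f (shift D b) (shift D a) = f b a" for b a
      unfolding completed_linearization_def by auto
    show "matrix_of D x y (?series f) b a = f b a"
    proof (cases "a \<in> fibre D x \<and> b \<in> fibre D y \<and> leq D a b")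
      case True
      \<comment> \<open>So the entry read off by \<open>?series\<close> has the same height
        difference as the entry at \<open>b\<close>, \<open>a\<close>, and shift invariance
        identifies the two.\<close>
      then have "int (excess D a b) + \<beta> x y = \<kappa> b - \<kappa> a"
        using excess_eq[OF xy] by simp
      then show ?thesis
        using True xy shift_invariant_depends_on_difference[of x y f, OF inv xy]
        by (simp add: matrix_of_def)
    qed (use supp tri in \<open>auto simp: matrix_of_def\<close>)
  qed
  show "matrix_of D x y ` UNIV \<subseteq> hom (completed_linearization D) x y"
    using xy
    by (auto simp: completed_linearization_def matrix_of_eq shift_fibre \<kappa>_shift leq_iff int_coeff_def)
qed simp

lemma category_isomorphism_matrix_of:
  "category_isomorphism (linearization fps_X (base D) (cocycle D))
    (completed_linearization D :: ('x, 'a \<Rightarrow> 'a \<Rightarrow> 'k::field) cat)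
    \<lparr>on_obj = (\<lambda>x. x), on_mor = matrix_of D\<rparr>"
proof (rule category_isomorphism_if_bij_betw_hom)
  show "category (linearization (fps_X :: 'k fps) (base D) (cocycle D))"
    using cyclic_poset by (rule category_linearization)
next
  fix x assume "x \<in> obj (linearization (fps_X :: 'k fps) (base D) (cocycle D))"
  then have "x \<in> base D" by (simp add: linearization_def)
  \<comment> \<open>The series 1 is supported in degree 0. As \<open>\<beta> x x = 0\<close>, this
    means equal heights, that is, the diagonal.\<close>
  then show "matrix_of D x x (ident (linearization (fps_X :: 'k fps) (base D) (cocycle D)) x) =
      ident (completed_linearization D) x"
    by (auto simp: linearization_def completed_linearization_def matrix_of_eq int_coeff_def \<beta>_refl
        \<kappa>_inject fun_eq_iff)
qed (auto simp: linearization_def completed_linearization_def fun_eq_iff matrix_of_comp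
  intro: bij_betw_matrix_of[unfolded completed_linearization_def, simplified])

lemma linear_on_homs_matrix_of:
  "linear_on_homs (base D) \<lparr>on_obj = (\<lambda>x. x), on_mor = matrix_of D\<rparr>"
  by (simp add: linear_on_homs_def matrix_of_def)

end

section \<open>Naturality\<close>

text \<open>\<open>matrix_of\<close> is built from fibres, order and shift alone, and
  \<open>q\<close> respects all three. The left-hand side is
  \<open>completed_linearization_map\<close> written out.\<close>

lemma matrix_of_natural:
  assumes iso: "cover_iso D E p q" and D: "covering_poset D"
    and xy: "x \<in> base D" "y \<in> base D"
  shows "(if b \<in> total E \<and> a \<in> total E
      then matrix_of D x y r (inv_into (total D) q b) (inv_into (total D) q a) else 0) =
    matrix_of E (p x) (p y) r b a"
proof (cases "b \<in> total E \<and> a \<in> total E")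
  case True
  have p: "inj_on p (base D)" and q: "bij_betw q (total D) (total E)"
    and leq_q: "\<And>a b. a \<in> total D \<Longrightarrow> b \<in> total D \<Longrightarrow> leq E (q a) (q b) \<longleftrightarrow> leq D a b"
    and proj_q: "\<And>a. a \<in> total D \<Longrightarrow> proj E (q a) = p (proj D a)"
    and shift_q: "\<And>a. a \<in> total D \<Longrightarrow> q (shift D a) = shift E (q a)"
    using iso unfolding cover_iso_def bij_betw_def by blast+
  have proj: "proj D a \<in> base D" and shift: "shift D a \<in> total D" if "a \<in> total D" for a
  proof -
    have "proj D ` total D = base D" "\<forall>a\<in>total D. shift D a \<in> fibre D (proj D a)"
      using D unfolding covering_poset_def by blast+
    then show "proj D a \<in> base D" "shift D a \<in> total D"
      using that by (auto simp: fibre_def)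
  qed
  obtain a' b' where a': "a' \<in> total D" "a = q a'" and b': "b' \<in> total D" "b = q b'"
    using True q unfolding bij_betw_def by blast
  \<comment> \<open>Injectivity of \<open>p\<close> gives the direction from left to right.\<close>
  have fibre_q: "q d \<in> fibre E (p w) \<longleftrightarrow> d \<in> fibre D w" if "d \<in> total D" "w \<in> base D" for d w
    using that inj_on_eq_iff[OF p proj[OF that(1)] that(2)] bij_betwE[OF q] by (simp add: fibre_def proj_q)
  have funpow_q: "(shift D ^^ n) a' \<in> total D \<and> (shift E ^^ n) (q a') = q ((shift D ^^ n) a')" for n
    by (induction n) (auto simp: a' shift shift_q)
  have "excess E a b = excess D a' b'"
    unfolding excess_def a' b' using funpow_q b' by (simp add: leq_q)
  moreover have "inv_into (total D) q a = a'" "inv_into (total D) q b = b'"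
    using a' b' bij_betw_inv_into_left[OF q] by blast+
  moreover have "a \<in> fibre E (p x) \<longleftrightarrow> a' \<in> fibre D x" "b \<in> fibre E (p y) \<longleftrightarrow> b' \<in> fibre D y"
    "leq E a b \<longleftrightarrow> leq D a' b'"
    using a' b' xy fibre_q leq_q by blast+
  ultimately show ?thesis
    using True by (simp add: matrix_of_def)
qed (auto simp: matrix_of_def fibre_def)

section \<open>Coordinates from a section\<close>

text \<open>Heights are measured from the section \<open>s\<close>, and \<open>\<beta>\<close> is
  \<open>b_sec D s\<close>. The main point is that the least integer defining \<open>b_sec\<close>
  exists.\<close>

lemma charted_cover_exists:
  assumes "covered_cyclic_poset D"
  obtains \<kappa> \<beta> where "charted_cover D \<kappa> \<beta>"
proof -
  have cyc: "cyclic_poset (base D) (cocycle D)" and str: "structure_cocycle D (cocycle D)"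
    and trans: "\<And>a b d. a \<in> total D \<Longrightarrow> b \<in> total D \<Longrightarrow> d \<in> total D \<Longrightarrow>
      leq D a b \<Longrightarrow> leq D b d \<Longrightarrow> leq D a d"
    and proj: "proj D ` total D = base D"
    and Z: "\<forall>x\<in>base D. \<exists>h. bij_betw h (fibre D x) (UNIV :: int set) \<and>
        (\<forall>a\<in>fibre D x. \<forall>b\<in>fibre D x. leq D a b \<longleftrightarrow> h a \<le> h b)"
    and bij_shift: "bij_betw (shift D) (total D) (total D)"
    and leq_shift: "\<And>a b. a \<in> total D \<Longrightarrow> b \<in> total D \<Longrightarrow>
      leq D (shift D a) (shift D b) \<longleftrightarrow> leq D a b"
    and shift_mem: "\<And>a. a \<in> total D \<Longrightarrow> shift D a \<in> fibre D (proj D a)"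
    and shift_gt: "\<And>a. a \<in> total D \<Longrightarrow> lt D a (shift D a)"
    and shift_least: "\<And>a b. a \<in> total D \<Longrightarrow> b \<in> fibre D (proj D a) \<Longrightarrow> lt D a b \<Longrightarrow>
      leq D (shift D a) b"
    and cofinal: "\<And>a b. a \<in> total D \<Longrightarrow> b \<in> total D \<Longrightarrow> \<exists>m::nat.
        leq D a ((shift D ^^ m) b) \<and> leq D ((shift D ^^ m) b) ((shift D ^^ (2 * m)) a)"
    using assms unfolding covered_cyclic_poset_def covering_poset_def by blast+
  obtain s where s: "\<And>x. x \<in> base D \<Longrightarrow> s x \<in> fibre D x"
    and cocycle: "\<And>x y z. x \<in> base D \<Longrightarrow> y \<in> base D \<Longrightarrow> z \<in> base D \<Longrightarrow>
      int (cocycle D x y z) = b_sec D s y z - b_sec D s x z + b_sec D s x y"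
    using str unfolding structure_cocycle_def is_section_def by blast
  obtain h where h: "\<And>x. x \<in> base D \<Longrightarrow> bij_betw (h x) (fibre D x) (UNIV :: int set)"
    and leq_h: "\<And>x a b. x \<in> base D \<Longrightarrow> a \<in> fibre D x \<Longrightarrow> b \<in> fibre D x \<Longrightarrow>
      leq D a b \<longleftrightarrow> h x a \<le> h x b"
    using bchoice[OF Z] by blast
  have fibreD: "a \<in> total D" "proj D a = x" "x \<in> base D" if "a \<in> fibre D x" for a x
    using that proj by (auto simp: fibre_def)
  have shift_fibre: "shift D a \<in> fibre D x" if "a \<in> fibre D x" for a x
    using shift_mem fibreD[OF that] by blast
  \<comment> \<open>The isomorphism of each fibre with the integers is translated to put the section
    at height 0.\<close>
  define \<kappa> where "\<kappa> a = h (proj D a) a - h (proj D a) (s (proj D a))" for a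
  have \<kappa>_eq: "\<kappa> a = h x a - h x (s x)" if "a \<in> fibre D x" for a x
    using fibreD[OF that] by (simp add: \<kappa>_def)
  have leq_fibre: "leq D a b \<longleftrightarrow> \<kappa> a \<le> \<kappa> b" if "a \<in> fibre D x" "b \<in> fibre D x" for a b x
    using leq_h[OF fibreD(3) that] that by (simp add: \<kappa>_eq)
  interpret graded_cover D \<kappa>
  proof
    fix x assume x: "x \<in> base D"
    have "bij_betw (\<lambda>i. i - h x (s x)) UNIV (UNIV :: int set)"
      by (rule bij_betw_byWitness[of _ "\<lambda>i. i + h x (s x)"]) auto
    from bij_betw_trans[OF h[OF x] this] show "bij_betw \<kappa> (fibre D x) UNIV"
      by (rule bij_betw_cong[THEN iffD1, rotated]) (simp add: \<kappa>_eq)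
  next
    fix a x assume a: "a \<in> fibre D x"
    then show "shift D a \<in> fibre D x" by (rule shift_fibre)
    have x: "x \<in> base D" using fibreD a by blast
    \<comment> \<open>Let \<open>b\<close> lie one step above \<open>a\<close>. Minimality of
      \<open>shift D a\<close> puts it at or below \<open>b\<close>, and strictness puts it above
      \<open>a\<close>, so it has the height of \<open>b\<close>.\<close>
    have "h x a + 1 \<in> h x ` fibre D x"
      using h[OF x] by (auto simp: bij_betw_def)
    then obtain b where b: "b \<in> fibre D x" "\<kappa> b = \<kappa> a + 1"
      using \<kappa>_eq a by fastforce
    have "leq D (shift D a) b"
      using a b fibreD[OF a] by (intro shift_least) (auto simp: lt_def leq_fibre)
    moreover have "lt D a (shift D a)"
      using shift_gt fibreD a by blast
    ultimately show "\<kappa> (shift D a) = \<kappa> a + 1"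
      using a b shift_fibre[OF a] leq_fibre by (auto simp: lt_def)
  qed
  \<comment> \<open>The order is itself invariant under the diagonal shift, since the shift is an
    automorphism.\<close>
  have leq_difference: "leq D a b \<longleftrightarrow> leq D a' b'"
    if "a \<in> fibre D x" "b \<in> fibre D y" "a' \<in> fibre D x" "b' \<in> fibre D y"
      "\<kappa> b - \<kappa> a = \<kappa> b' - \<kappa> a'" for a b a' b' x y
    by (rule shift_invariant_depends_on_difference[of x y "\<lambda>b a. leq D a b", OF _ _ _ that])
      (use leq_shift fibreD that in blast)+
  have \<kappa>_s: "\<kappa> (s x) = 0" if "x \<in> base D" for x
    using \<kappa>_eq s that by fastforce
  have shift_pow_s: "shift_pow D m (s y) = at_height y m" if y: "y \<in> base D" for y m
  proof -
    have inv: "inv_into (total D) (shift D) (at_height y i) = at_height y (i - 1)" for i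
    proof -
      have "shift D (at_height y (i - 1)) = at_height y i"
        using y by (simp add: shift_fibre \<kappa>_shift[of _ y] flip: \<kappa>_inject[OF y])
      then show ?thesis
        using bij_betw_inv_into_left[OF bij_shift fibreD(1)[OF at_height_fibre[OF y]]] by metis
    qed
    have "(inv_into (total D) (shift D) ^^ n) (at_height y i) = at_height y (i - int n)" for n i
      by (induction n) (simp_all add: inv algebra_simps)
    moreover have "(shift D ^^ n) (at_height y i) = at_height y (i + int n)" for n i
      using y shift_funpow[OF at_height_fibre[OF y]] by (simp flip: \<kappa>_inject[OF y])
    moreover have "s y = at_height y 0"
      using y s \<kappa>_s by (simp flip: \<kappa>_inject[OF y])
    ultimately show ?thesis
      by (simp add: shift_pow_def)
  qed
  \<comment> \<open>The heights over \<open>y\<close> at or above \<open>s x\<close> form an up-set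
    of integers. Cofinality makes it nonempty and bounded below, so it has a least element.\<close>
  have leq_b_sec: "leq D (s x) (at_height y i) \<longleftrightarrow> b_sec D s x y \<le> i"
    if xy: "x \<in> base D" "y \<in> base D" for x y i
  proof -
    define P where "P j \<longleftrightarrow> leq D (s x) (at_height y j)" for j
    note in_total = fibreD(1)[OF s[OF xy(1)]] fibreD(1)[OF at_height_fibre[OF xy(2)]]
    have up: "P k" if "P j" "j \<le> k" for j k
      using that trans[OF in_total in_total(2), of j k] xy
      by (auto simp: P_def leq_fibre[of _ y])
    obtain m where m: "leq D (s x) ((shift D ^^ m) (s y))"
        "leq D ((shift D ^^ m) (s y)) ((shift D ^^ (2 * m)) (s x))"
      using cofinal fibreD s xy by meson
    have pow_s: "(shift D ^^ n) (s w) = at_height w (int n)" if "w \<in> base D" for n w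
      using shift_pow_s[OF that, of "int n"] by (simp add: shift_pow_def)
    have Pm: "P (int m)"
      using m(1) xy by (simp add: P_def pow_s)
    \<comment> \<open>Shifting \<open>s x\<close> and the element of height \<open>j\<close> by
      \<open>2 * m\<close> and using the second half of cofinality gives
      \<open>m \<le> j + 2 * m\<close>.\<close>
    have bound: "- int m \<le> j" if "P j" for j
    proof -
      have "leq D (at_height x (2 * int m)) (at_height y (j + 2 * int m))"
        using \<open>P j\<close> leq_difference[of "s x" x "at_height y j" y "at_height x (2 * int m)"
          "at_height y (j + 2 * int m)"] xy s \<kappa>_s by (simp add: P_def)
      moreover have "leq D (at_height y (int m)) (at_height x (2 * int m))"
        using m(2) xy by (simp add: pow_s)
      ultimately have "leq D (at_height y (int m)) (at_height y (j + 2 * int m))"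
        using trans fibreD at_height_fibre xy by meson
      then show ?thesis
        using xy by (simp add: leq_fibre[of _ y])
    qed
    \<comment> \<open>Adding \<open>m\<close> moves the lower bound to 0, so the minimum can be
      taken over the well-ordered naturals.\<close>
    define l where "l = (LEAST n. P (int n - int m))"
    have "P (int (2 * m) - int m)" using Pm by simp
    then have Pl: "P (int l - int m)" unfolding l_def by (rule LeastI)
    have least: "int l - int m \<le> j" if "P j" for j
    proof -
      have "int (nat (j + int m)) - int m = j" using that bound by fastforce
      then have "P (int (nat (j + int m)) - int m)" using that by simp
      then have "l \<le> nat (j + int m)" unfolding l_def by (rule Least_le)
      then show ?thesis using bound that by fastforce
    qed
    have "b_sec D s x y = int l - int m"
      unfolding b_sec_def shift_pow_s[OF xy(2)]
      by (rule Least_equality) (use Pl least in \<open>auto simp: P_def\<close>)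
    then have "P i \<longleftrightarrow> b_sec D s x y \<le> i"
      using up[OF Pl] least by metis
    then show ?thesis
      by (simp only: P_def)
  qed
  have "charted_cover D \<kappa> (b_sec D s)"
  proof
    fix x y a b
    assume xy: "x \<in> base D" "y \<in> base D" and ab: "a \<in> fibre D x" "b \<in> fibre D y"
    \<comment> \<open>Lowering both heights by \<open>\<kappa> a\<close> moves \<open>a\<close> to
      the section.\<close>
    have "leq D a b \<longleftrightarrow> leq D (s x) (at_height y (\<kappa> b - \<kappa> a))"
      using leq_difference[OF ab] xy s \<kappa>_s by simp
    then show "leq D a b \<longleftrightarrow> 0 \<le> \<kappa> b - \<kappa> a - b_sec D s x y"
      using leq_b_sec[OF xy] by simp
  qed (fact cyc, fact cocycle)
  then show thesis by (rule that)
qed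

section \<open>The natural isomorphism\<close>

theorem proposition1p2p7:
  "\<exists>\<Theta> :: ('x, 'a) cyclic_cover \<Rightarrow> ('x, 'k::field fps, 'x, 'a \<Rightarrow> 'a \<Rightarrow> 'k) functr.
     (\<forall>D. covered_cyclic_poset D \<longrightarrow>
        category_isomorphism (linearization fps_X (base D) (cocycle D))
          (completed_linearization D) (\<Theta> D) \<and>
        (\<forall>x\<in>base D. on_obj (\<Theta> D) x = x) \<and>
        linear_on_homs (base D) (\<Theta> D)) \<and>
     (\<forall>D E p q. covered_cyclic_poset D \<longrightarrow> covered_cyclic_poset E \<longrightarrow> cover_iso D E p q \<longrightarrow>
        functor_eq (linearization fps_X (base D) (cocycle D))
          (functor_comp (completed_linearization_map D E p q) (\<Theta> D))
          (functor_comp (\<Theta> E) (linearization_map p)))"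
\<comment> \<open>The witness involves no choice of section, so the same formula serves all covers
  and can be compared along \<open>cover_iso\<close>.\<close>
proof (intro exI[of _ "\<lambda>D. \<lparr>on_obj = (\<lambda>x. x), on_mor = matrix_of D\<rparr>"] conjI allI impI)
  fix D :: "('x, 'a) cyclic_cover"
  assume "covered_cyclic_poset D"
  then obtain \<kappa> \<beta> where "charted_cover D \<kappa> \<beta>"
    by (rule charted_cover_exists)
  then interpret charted_cover D \<kappa> \<beta> .
  let ?\<Theta> = "\<lparr>on_obj = (\<lambda>x. x), on_mor = matrix_of D\<rparr> :: ('x, 'k fps, 'x, 'a \<Rightarrow> 'a \<Rightarrow> 'k) functr"
  show "category_isomorphism (linearization fps_X (base D) (cocycle D)) (completed_linearization D) ?\<Theta>"
    by (rule category_isomorphism_matrix_of)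
  show "\<forall>x\<in>base D. on_obj ?\<Theta> x = x" by simp
  show "linear_on_homs (base D) ?\<Theta>" by (rule linear_on_homs_matrix_of)
next
  fix D E :: "('x, 'a) cyclic_cover" and p q
  assume "covered_cyclic_poset D" and "cover_iso D E p q"
  then show "functor_eq (linearization (fps_X :: 'k fps) (base D) (cocycle D))
      (functor_comp (completed_linearization_map D E p q) \<lparr>on_obj = (\<lambda>x. x), on_mor = matrix_of D\<rparr>)
      (functor_comp \<lparr>on_obj = (\<lambda>x. x), on_mor = matrix_of E\<rparr> (linearization_map p))"
    by (auto simp: functor_eq_def functor_comp_def linearization_map_def linearization_def
        completed_linearization_map_def covered_cyclic_poset_def fun_eq_iff matrix_of_natural)
qed

end
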